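(* Let $m\ge 1$ be an integer and $h>0$ a real number. Let $\lambda_1,\dots,\lambda_{m-1}$ be the roots of the Euler polynomial $E_{2m-2}(\lambda)$ that are less than one in absolute value, $|\lambda_k|<1$. Then the discrete analogue $D_m[\beta]$, $\beta\in\mathbb{Z}$, of the differential operator $\frac{d^{2m}}{dx^{2m}}$ (i.e. the function on $\mathbb{Z}$ satisfying $h\,D_m[\beta]*G_m[\beta]=\delta[\beta]$) has the form $$ D_m[\beta]=\frac{(2m-1)!}{h^{2m}}\begin{cases} \displaystyle\sum_{k=1}^{m-1}\frac{(1-\lambda_k)^{2m+1}\lambda_k^{|\beta|}}{\lambda_k E_{2m-1}(\lambda_k)} & \text{for } |\beta|\ge 2,\\[2mm] \displaystyle 1+\sum_{k=1}^{m-1}\frac{(1-\lambda_k)^{2m+1}}{E_{2m-1}(\lambda_k)} & \text{for } |\beta|=1,\\[2mm] \displaystyle -2^{2m-1}+\sum_{k=1}^{m-1}\frac{(1-\lambda_k)^{2m+1}}{\lambda_k E_{2m-1}(\lambda_k)} & \text{for } \beta=0. \end{cases} $$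
   Context: Euler polynomials: for an integer $k\ge 0$, $E_k(\lambda)$ is the polynomial of degree $k$ defined by $\lambda E_k(\lambda)=(1-\lambda)^{k+2}D^k\frac{\lambda}{(1-\lambda)^2}$, where $D=\lambda\frac{d}{d\lambda}$ and $D^k=\lambda\frac{d}{d\lambda}D^{k-1}$ (these are the Euler-Frobenius polynomials, e.g. $E_0=1$, $E_1=\lambda+1$, $E_2=\lambda^2+4\lambda+1$). It is known (Frobenius) that all $k$ roots of $E_k$ are real, negative and distinct, $\lambda_1^{(k)}<\dots<\lambda_k^{(k)}<0$, and $\lambda_j^{(k)}\lambda_{k+1-j}^{(k)}=1$; hence $E_{2m-2}$ has exactly $m-1$ roots of modulus less than $1$. Functions of discrete argument are functions on $\mathbb{Z}$; $h>0$ is the lattice step. Put $G_m[\beta]=\frac{(h\beta)^{2m-1}\operatorname{sign}(h\beta)}{2\,(2m-1)!}$, and $\delta[\beta]=1$ if $\beta=0$, $\delta[\beta]=0$ otherwise. Convolution is $\varphi[\beta]*\psi[\beta]=\sum_{\gamma\in\mathbb{Z}}\varphi[\gamma]\psi[\beta-\gamma]$. The discrete analogue of $d^{2m}/dx^{2m}$ is the function $D_m:\mathbb{Z}\to\mathbb{R}$ such that $h\,D_m[\beta]*G_m[\beta]=\delta[\beta]$ for all $\beta\in\mathbb{Z}$, where the convolution series are required to converge absolutely. Empty sums are zero. *)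

theory Defs
  imports "HOL-Analysis.Analysis" "HOL-Computational_Algebra.Polynomial"
begin

definition euler_op :: "(real \<Rightarrow> real) \<Rightarrow> real \<Rightarrow> real" where
  "euler_op f = (\<lambda>x. x * deriv f x)"

text \<open>The point \<open>x = 1\<close> is excluded because \<open>x / (1 - x)\<^sup>2\<close> has a pole there.\<close>

definition is_euler_poly :: "nat \<Rightarrow> real poly \<Rightarrow> bool" where
  "is_euler_poly k p \<longleftrightarrow> degree p = k \<and>
     (\<forall>x. x \<noteq> 1 \<longrightarrow>
        x * poly p x = (1 - x) ^ (k + 2) * (euler_op ^^ k) (\<lambda>y. y / (1 - y)\<^sup>2) x)"

definition euler_poly :: "nat \<Rightarrow> real poly" where
  "euler_poly k = (THE p. is_euler_poly k p)"

lemma is_euler_poly_unique: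
  assumes "is_euler_poly k p" "is_euler_poly k q"
  shows "p = q"
proof (rule ccontr)
  assume "p \<noteq> q"
  then have "finite {x. poly (p - q) x = 0}"
    by (intro poly_roots_finite) simp
  moreover have "{2::real<..} \<subseteq> {x. poly (p - q) x = 0}"
  proof
    fix x :: real
    assume "x \<in> {2<..}"
    then have x: "x \<noteq> 1" "x \<noteq> 0"
      by auto
    then have "x * poly p x = x * poly q x"
      using assms unfolding is_euler_poly_def by metis
    with x show "x \<in> {x. poly (p - q) x = 0}"
      by simp
  qed
  ultimately show False
    using infinite_Ioi finite_subset by blast
qed

lemma euler_op_iterate_step:
  assumes eq: "\<And>x::real. x \<noteq> 1 \<Longrightarrow> F x = x * poly p x / (1 - x) ^ (k + 2)"
    and x: "x \<noteq> 1"
  shows "euler_op F x =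
    x * poly ([:1, of_nat (k + 1):] * p + [:0, 1, -1:] * pderiv p) x / (1 - x) ^ (k + 3)"
proof -
  let ?g = "\<lambda>x::real. x * poly p x / (1 - x) ^ (k + 2)"
  have x': "1 - x \<noteq> 0"
    using x by simp
  have F: "deriv F x = deriv ?g x"
  proof (rule deriv_cong_ev[OF _ refl])
    have "\<forall>\<^sub>F y in nhds x. y \<in> - {1::real}"
      by (rule eventually_nhds_in_open) (use x in auto)
    then show "\<forall>\<^sub>F y in nhds x. F y = ?g y"
      by eventually_elim (use eq in auto)
  qed
  have "(?g has_field_derivative
      ((poly p x + x * poly (pderiv p) x) * (1 - x) ^ (k + 2)
        - (x * poly p x) * (of_nat (k + 2) * (1 - x) ^ (k + 1) * (-1)))
      / ((1 - x) ^ (k + 2) * (1 - x) ^ (k + 2))) (at x)"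
  proof (rule DERIV_divide)
    show "((\<lambda>x. x * poly p x) has_field_derivative poly p x + x * poly (pderiv p) x) (at x)"
      using DERIV_mult[OF DERIV_ident poly_DERIV] by (simp add: add.commute mult.commute)
    show "((\<lambda>x. (1 - x) ^ (k + 2)) has_field_derivative
        of_nat (k + 2) * (1 - x) ^ (k + 1) * (-1)) (at x)"
    proof -
      have "((\<lambda>x. 1 - x) has_field_derivative 0 - 1) (at x)"
        by (rule DERIV_diff[OF DERIV_const DERIV_ident])
      from DERIV_power[OF this, of "k + 2"] show ?thesis
        by (rule DERIV_cong) simp
    qed
    show "(1 - x) ^ (k + 2) \<noteq> 0"
      using x' by simp
  qed
  then have "deriv ?g x =
      ((poly p x + x * poly (pderiv p) x) * (1 - x) ^ (k + 2)
        - (x * poly p x) * (of_nat (k + 2) * (1 - x) ^ (k + 1) * (-1)))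
      / ((1 - x) ^ (k + 2) * (1 - x) ^ (k + 2))"
    by (rule DERIV_imp_deriv)
  with F have "deriv F x = \<dots>"
    by (rule trans)
  also have "\<dots> = (1 - x) ^ (k + 1)
        * ((poly p x + x * poly (pderiv p) x) * (1 - x) + of_nat (k + 2) * x * poly p x)
      / ((1 - x) ^ (k + 1) * (1 - x) ^ (k + 3))"
    by (simp add: algebra_simps eval_nat_numeral)
  also have "\<dots> = ((poly p x + x * poly (pderiv p) x) * (1 - x) + of_nat (k + 2) * x * poly p x)
      / (1 - x) ^ (k + 3)"
    using x' by (subst mult_divide_mult_cancel_left) auto
  finally have d: "deriv F x = \<dots>" .
  have "(poly p x + x * poly (pderiv p) x) * (1 - x) + of_nat (k + 2) * x * poly p x
      = poly ([:1, of_nat (k + 1):] * p + [:0, 1, -1:] * pderiv p) x"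
    by (simp add: algebra_simps)
  with d show ?thesis
    unfolding euler_op_def by simp
qed

lemma euler_poly_recurrence_degree:
  fixes p :: "real poly"
  assumes "degree p = k" "lead_coeff p = 1"
  defines "q \<equiv> [:1, of_nat (k + 1):] * p + [:0, 1, -1:] * pderiv p"
  shows "degree q = k + 1" "lead_coeff q = 1"
proof -
  have c: "coeff q (Suc n) = coeff p (Suc n) + of_nat (k + 1) * coeff p n
      + of_nat (Suc n) * coeff p (Suc n) - of_nat n * coeff p n" for n
    by (cases n) (simp_all add: q_def coeff_pderiv)
  have z: "coeff p n = 0" if "n > k" for n
    using that assms(1) by (simp add: coeff_eq_0)
  have one: "coeff q (Suc k) = 1"
    using assms(1,2) z[of "Suc k"] by (simp add: c)
  have "degree q \<le> Suc k"
  proof (rule degree_le, intro allI impI)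
    fix n assume n: "Suc k < n"
    then obtain n' where "n = Suc n'" "n' > k"
      by (cases n) auto
    then show "coeff q n = 0"
      by (simp add: c z)
  qed
  with one show "degree q = k + 1"
    by (metis Suc_eq_plus1 le_antisym le_degree zero_neq_one)
  with one show "lead_coeff q = 1"
    by simp
qed

lemma is_euler_poly_exists: "\<exists>p. is_euler_poly k p"
proof -
  have "\<exists>p. degree p = k \<and> lead_coeff p = 1 \<and>
     (\<forall>x. x \<noteq> 1 \<longrightarrow>
        (euler_op ^^ k) (\<lambda>y. y / (1 - y)\<^sup>2) x = x * poly p x / (1 - x) ^ (k + 2))"
  proof (induction k)
    case 0
    show ?case
      by (rule exI[of _ 1]) (auto simp: power2_eq_square)
  next
    case (Suc k)
    then obtain p where p: "degree p = k" "lead_coeff p = 1"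
      "\<And>x. x \<noteq> 1 \<Longrightarrow>
        (euler_op ^^ k) (\<lambda>y. y / (1 - y)\<^sup>2) x = x * poly p x / (1 - x) ^ (k + 2)"
      by blast
    let ?q = "[:1, of_nat (k + 1):] * p + [:0, 1, -1:] * pderiv p"
    have "(euler_op ^^ Suc k) (\<lambda>y. y / (1 - y)\<^sup>2) x = x * poly ?q x / (1 - x) ^ (Suc k + 2)"
      if "x \<noteq> 1" for x
    proof -
      have "euler_op ((euler_op ^^ k) (\<lambda>y. y / (1 - y)\<^sup>2)) x = x * poly ?q x / (1 - x) ^ (k + 3)"
        by (rule euler_op_iterate_step) (use p(3) that in blast)+
      moreover have "k + 3 = Suc k + 2"
        by simp
      ultimately show ?thesis
        by (simp only: funpow.simps o_apply)
    qed
    moreover have "degree ?q = Suc k" "lead_coeff ?q = 1"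
      using euler_poly_recurrence_degree[OF p(1,2)] by (simp_all only: Suc_eq_plus1)
    ultimately show ?case
      by blast
  qed
  then obtain p where p: "degree p = k"
     "\<And>x. x \<noteq> 1 \<Longrightarrow>
        (euler_op ^^ k) (\<lambda>y. y / (1 - y)\<^sup>2) x = x * poly p x / (1 - x) ^ (k + 2)"
    by blast
  have "is_euler_poly k p"
    unfolding is_euler_poly_def
  proof (intro conjI allI impI)
    show "degree p = k"
      by (rule p(1))
  next
    fix x :: real
    assume "x \<noteq> 1"
    then show "x * poly p x = (1 - x) ^ (k + 2) * (euler_op ^^ k) (\<lambda>y. y / (1 - y)\<^sup>2) x"
      by (subst p(2)) simp_all
  qed
  then show ?thesis ..
qed

lemma is_euler_poly_euler_poly: "is_euler_poly k (euler_poly k)"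
  unfolding euler_poly_def
  by (rule theI') (use is_euler_poly_exists is_euler_poly_unique in blast)

definition discrete_G :: "nat \<Rightarrow> real \<Rightarrow> int \<Rightarrow> real" where
  "discrete_G m h \<beta> =
     (h * of_int \<beta>) ^ (2 * m - 1) * sgn (h * of_int \<beta>) / (2 * fact (2 * m - 1))"

definition discrete_delta :: "int \<Rightarrow> real" where
  "discrete_delta \<beta> = (if \<beta> = 0 then 1 else 0)"

definition discrete_conv :: "(int \<Rightarrow> real) \<Rightarrow> (int \<Rightarrow> real) \<Rightarrow> int \<Rightarrow> real" where
  "discrete_conv \<phi> \<psi> \<beta> = (\<Sum>\<^sub>\<infinity>\<gamma>\<in>UNIV. \<phi> \<gamma> * \<psi> (\<beta> - \<gamma>))"

text \<open>Absolute convergence is stated explicitly since \<^const>\<open>infsum\<close> is \<open>0\<close> on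
  families that are not summable.\<close>

definition is_discrete_analogue :: "nat \<Rightarrow> real \<Rightarrow> (int \<Rightarrow> real) \<Rightarrow> bool" where
  "is_discrete_analogue m h D \<longleftrightarrow>
     (\<forall>\<beta>. (\<lambda>\<gamma>. \<bar>D \<gamma> * discrete_G m h (\<beta> - \<gamma>)\<bar>) summable_on UNIV \<and>
          h * discrete_conv D (discrete_G m h) \<beta> = discrete_delta \<beta>)"

end

theory Submission
  imports Defs
begin

text \<open>Write \<open>m = M + 1\<close> and \<open>n = 2 * M + 1\<close>. A convolution inverse of \<open>\<bar>\<beta>\<bar> ^ n\<close> is unique by
  associativity, so it suffices to check that the stated function is one. For \<open>\<beta> \<ge> 0\<close>,
  \<open>\<bar>\<beta> - \<gamma>\<bar> ^ n\<close> is the polynomial \<open>(\<beta> - \<gamma>) ^ n\<close> plus twice its one-sided negative part. The one-sided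
  part contributes \<open>\<Sum>i\<ge>1. i ^ n * x ^ i = x * E\<^sub>2\<^sub>M(x) / (1 - x) ^ (n + 1)\<close>, which vanishes at the roots
  \<open>x\<close>. The polynomial part contributes the moments of order up to \<open>n\<close>; by the symmetry \<open>x \<mapsto> 1 / x\<close> they
  become sums of \<open>Q(w) / W'(w)\<close> over all roots \<open>w\<close> of \<open>W = x * E\<^sub>2\<^sub>M\<close> and vanish by Lagrange
  interpolation: the \<open>M\<close> roots of \<open>E\<^sub>2\<^sub>M\<close> in \<open>(-1, 1)\<close> and their inverses are all its roots.\<close>

subsection \<open>Euler polynomials\<close>

lemma euler_op_iterate:
  assumes "x \<noteq> 1"
  shows "(euler_op ^^ k) (\<lambda>y. y / (1 - y)\<^sup>2) x = x * poly (euler_poly k) x / (1 - x) ^ (k + 2)"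
proof -
  have "x * poly (euler_poly k) x =
      (1 - x) ^ (k + 2) * (euler_op ^^ k) (\<lambda>y. y / (1 - y)\<^sup>2) x"
    using is_euler_poly_euler_poly[of k] assms unfolding is_euler_poly_def by blast
  with assms show ?thesis
    by simp
qed

lemma degree_euler_poly [simp]: "degree (euler_poly k) = k"
  using is_euler_poly_euler_poly[of k] by (simp add: is_euler_poly_def)

lemma euler_poly_0 [simp]: "euler_poly 0 = 1"
  by (rule is_euler_poly_unique[OF is_euler_poly_euler_poly])
    (auto simp: is_euler_poly_def power2_eq_square)

text \<open>The degree half of \<open>is_euler_poly\<close> comes from
  \<open>euler_poly_recurrence_degree\<close>, which asks for a monic polynomial; the induction in
  \<open>lead_coeff_euler_poly\<close> discharges the assumption.\<close>

lemma euler_poly_Suc_aux: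
  assumes lead: "lead_coeff (euler_poly k) = 1"
  shows "euler_poly (Suc k) =
    [:1, of_nat (k + 1):] * euler_poly k + [:0, 1, -1:] * pderiv (euler_poly k)" (is "_ = ?q")
proof (rule is_euler_poly_unique[OF is_euler_poly_euler_poly])
  show "is_euler_poly (Suc k) ?q"
    unfolding is_euler_poly_def
  proof (intro conjI allI impI)
    show "degree ?q = Suc k"
      using euler_poly_recurrence_degree(1)[OF degree_euler_poly lead] by simp
  next
    fix x :: real
    assume x: "x \<noteq> 1"
    have "euler_op ((euler_op ^^ k) (\<lambda>y. y / (1 - y)\<^sup>2)) x = x * poly ?q x / (1 - x) ^ (k + 3)"
      by (rule euler_op_iterate_step[OF euler_op_iterate x])
    moreover have "Suc k + 2 = k + 3"
      by simp
    ultimately show "x * poly ?q x =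
        (1 - x) ^ (Suc k + 2) * (euler_op ^^ Suc k) (\<lambda>y. y / (1 - y)\<^sup>2) x"
      using x by (simp only: funpow.simps o_apply) simp
  qed
qed

lemma lead_coeff_euler_poly: "lead_coeff (euler_poly k) = 1"
proof (induction k)
  case (Suc k)
  then show ?case
    using euler_poly_recurrence_degree(2)[of "euler_poly k" k] by (simp add: euler_poly_Suc_aux)
qed simp

lemmas euler_poly_Suc = euler_poly_Suc_aux[OF lead_coeff_euler_poly]

section \<open>Coefficients and the symmetry under inversion of the argument\<close>

lemma coeff_euler_poly_0: "coeff (euler_poly k) 0 = 1"
  by (induction k) (simp_all add: euler_poly_Suc)

lemma poly_euler_poly_at_0 [simp]: "poly (euler_poly k) 0 = 1"
  by (simp add: poly_0_coeff_0 coeff_euler_poly_0)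

text \<open>This is the recurrence of the Eulerian numbers: coefficient i of E_k counts the
  permutations of k + 1 elements with i descents.\<close>

lemma coeff_euler_poly_Suc:
  "coeff (euler_poly (Suc k)) (Suc i) =
     (real i + 2) * coeff (euler_poly k) (Suc i) + (real k + 1 - real i) * coeff (euler_poly k) i"
  by (cases i) (simp_all add: euler_poly_Suc coeff_pderiv algebra_simps)

lemma coeff_euler_poly_1: "coeff (euler_poly k) 1 = 2 ^ (k + 1) - real k - 2"
proof (induction k)
  case (Suc k)
  then show ?case
    using coeff_euler_poly_Suc[of k 0] by (simp add: coeff_euler_poly_0)
qed simp

text \<open>The factors i + 2 and k + 1 - i of the coefficient recurrence trade places under i -> k
  - 1 - i, so the symmetry passes from k to k + 1.\<close>

lemma coeff_euler_poly_palindromic: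
  assumes "i \<le> k"
  shows "coeff (euler_poly k) (k - i) = coeff (euler_poly k) i"
  using assms
proof (induction k arbitrary: i)
  case (Suc k)
  have sym: "coeff (euler_poly (Suc k)) (Suc k - Suc j) = coeff (euler_poly (Suc k)) (Suc j)"
    if "j < k" for j
  proof -
    from that have k: "k - j = Suc (k - Suc j)"
      by simp
    have "coeff (euler_poly k) (k - Suc j) = coeff (euler_poly k) (Suc j)"
      "coeff (euler_poly k) (k - j) = coeff (euler_poly k) j"
      using Suc.IH[of "Suc j"] Suc.IH[of j] that by simp_all
    then show ?thesis
      using that coeff_euler_poly_Suc[of k "k - Suc j"] coeff_euler_poly_Suc[of k j]
      by (simp add: k[symmetric] of_nat_diff algebra_simps)
  qed
  \<comment> \<open>The pairing needs an interior index; the end coefficients are both 1, as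
    constant and leading coefficient.\<close>
  consider "i = 0" | "i = Suc k" | j where "i = Suc j" "j < k"
    using Suc.prems by (cases i) force+
  then show ?case
  proof cases
    case 1
    then show ?thesis
      using lead_coeff_euler_poly[of "Suc k"] by (simp add: coeff_euler_poly_0)
  next
    case 2
    then show ?thesis
      using lead_coeff_euler_poly[of "Suc k"] by (simp add: coeff_euler_poly_0)
  qed (use sym in blast)
qed simp

lemma reflect_euler_poly [simp]: "reflect_poly (euler_poly k) = euler_poly k"
  by (rule poly_eqI) (auto simp: coeff_reflect_poly coeff_euler_poly_palindromic coeff_eq_0)

lemma poly_euler_poly_inverse:
  "x \<noteq> 0 \<Longrightarrow> poly (euler_poly k) x = x ^ k * poly (euler_poly k) (inverse x)"
  using poly_reflect_poly_nz[of x "euler_poly k"] by simp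

text \<open>Only the derivative term of the recurrence survives at a root. This turns the
  denominators E_{2m-1}(lambda_k) into derivatives of E_{2m-2}, the form in which Lagrange
  interpolation produces them.\<close>

lemma poly_euler_poly_Suc_root:
  assumes "poly (euler_poly k) x = 0"
  shows "poly (euler_poly (Suc k)) x = x * (1 - x) * poly (pderiv (euler_poly k)) x"
  using assms by (simp add: euler_poly_Suc algebra_simps)

lemma euler_poly_root_nz: "poly (euler_poly k) x = 0 \<Longrightarrow> x \<noteq> 0"
  by auto

text \<open>Differentiate E(x) = x^k E(1/x); the term with the derivative of x^k drops out because
  1/x is a root too.\<close>

lemma pderiv_euler_poly_inverse:
  assumes r: "poly (euler_poly k) x = 0" and k: "k > 0"
  shows "x ^ k * poly (pderiv (euler_poly k)) (inverse x) = - (x ^ 2 * poly (pderiv (euler_poly k)) x)"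
proof -
  have x: "x \<noteq> 0"
    using euler_poly_root_nz[OF r] .
  have r': "poly (euler_poly k) (inverse x) = 0"
    using poly_euler_poly_inverse[OF x, of k] r x by simp
  have deriv: "((\<lambda>y. y ^ k * poly (euler_poly k) (inverse y)) has_field_derivative
      x ^ k * (poly (pderiv (euler_poly k)) (inverse x) * (- (inverse x ^ 2)))) (at x)"
    using x r' by (auto intro!: derivative_eq_intros DERIV_chain'[where g = "poly (euler_poly k)"]
       simp: power2_eq_square)
  \<comment> \<open>The identity is available only away from 0, hence on a neighbourhood of
    \<open>x\<close>.\<close>
  have ev: "\<forall>\<^sub>F y in nhds x. y ^ k * poly (euler_poly k) (inverse y) = poly (euler_poly k) y"
    using t1_space_nhds[OF x]
    by eventually_elim (simp add: poly_euler_poly_inverse[symmetric])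
  have "(poly (euler_poly k) has_field_derivative
      x ^ k * (poly (pderiv (euler_poly k)) (inverse x) * (- (inverse x ^ 2)))) (at x)"
    by (rule DERIV_cong_ev[OF refl ev refl, THEN iffD1]) (rule deriv)
  then have "x ^ k * (poly (pderiv (euler_poly k)) (inverse x) * (- (inverse x ^ 2))) =
      poly (pderiv (euler_poly k)) x"
    using DERIV_unique poly_DERIV by blast
  then show ?thesis
    using x by (simp add: field_simps)
qed

text \<open>Induction on \<open>k\<close>: x d/dx raises the exponent of the index by one when
  applied termwise, and raises \<open>k\<close> by one in the closed form.\<close>

lemma power_sums_has_sum:
  fixes x :: real
  assumes x: "\<bar>x\<bar> < 1"
  shows "((\<lambda>i. real (Suc i) ^ Suc k * x ^ Suc i) has_sum
    x * poly (euler_poly k) x / (1 - x) ^ (k + 2)) UNIV"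
proof -
  define F where "F k x = x * poly (euler_poly k) x / (1 - x) ^ (k + 2)" for k and x :: real
  \<comment> \<open>Starting at index 0 gives a power series that can be differentiated termwise;
    the extra term is 0 because the exponent is positive.\<close>
  have sums: "(\<lambda>i. real i ^ Suc k * x ^ i) sums F k x" if "\<bar>x\<bar> < 1" for x
    using that
  proof (induction k arbitrary: x)
    case 0
    then have "(\<lambda>i. of_nat (Suc i) * x ^ i) sums (1 / (1 - x)\<^sup>2)"
      by (intro geometric_deriv_sums) simp
    from sums_mult[OF this, of x] show ?case
      using sums_Suc_iff[of "\<lambda>i. real i ^ Suc 0 * x ^ i" "F 0 x"]
      by (simp add: F_def mult_ac power2_eq_square)
  next
    case (Suc k)
    have x: "x \<noteq> 1"
      using Suc.prems by auto
    have "(F k has_field_derivative deriv (F k) x) (at x)"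
      unfolding F_def DERIV_deriv_iff_real_differentiable
      using x by (intro derivative_intros) (auto intro: differentiableI poly_DERIV)
    from termdiffs_sums_strong[OF _ this, of 1 "\<lambda>i. real i ^ Suc k"]
    have "(\<lambda>i. diffs (\<lambda>i. real i ^ Suc k) i * x ^ i) sums deriv (F k) x"
      using Suc.IH Suc.prems by simp
    from sums_mult[OF this, of x]
    have "(\<lambda>i. real (Suc i) ^ Suc (Suc k) * x ^ Suc i) sums euler_op (F k) x"
      by (simp add: diffs_def euler_op_def mult_ac)
    also have "euler_op (F k) x = F (Suc k) x"
      using euler_op_iterate_step[of "F k" "euler_poly k" k x] x
      by (simp add: F_def euler_poly_Suc eval_nat_numeral)
    finally show ?case
      using sums_Suc_iff[of "\<lambda>i. real i ^ Suc (Suc k) * x ^ i" "F (Suc k) x"] by simp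
  qed
  have "(\<lambda>i. real (Suc i) ^ Suc k * y ^ Suc i) sums F k y" if "\<bar>y\<bar> < 1" for y
    using sums[OF that] sums_Suc_iff[of "\<lambda>i. real i ^ Suc k * y ^ i" "F k y"] by simp
  \<comment> \<open>The instance at \<open>\<bar>x\<bar>\<close> gives the absolute convergence that
    \<open>has_sum\<close> demands.\<close>
  from this[of x] this[of "\<bar>x\<bar>"] x show ?thesis
    unfolding F_def
    by (intro norm_summable_imp_has_sum) (auto simp: abs_mult power_abs sums_iff)
qed

subsection \<open>Sums over simple roots\<close>

text \<open>Lagrange interpolation: \<open>S\<close> has as many points as the degree of
  \<open>W\<close>, so all roots are simple and the values W'(w) are the denominators of the basis
  polynomials. The identity compares coefficients of degree \<open>n\<close>.\<close>

lemma sum_poly_div_pderiv: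
  fixes W Q :: "'a :: field poly"
  assumes S: "finite S" "card S = Suc n" and W: "\<And>w. w \<in> S \<Longrightarrow> poly W w = 0"
    and dW: "degree W = Suc n" "lead_coeff W = 1" and Q: "degree Q \<le> n"
  shows "(\<Sum>w\<in>S. poly Q w / poly (pderiv W) w) = coeff Q n"
proof -
  \<comment> \<open>Numerator of the Lagrange basis polynomial at \<open>w\<close>: monic of degree
    \<open>n\<close>, with value W'(w) at \<open>w\<close>, for \<open>w\<close> in
    \<open>S\<close>.\<close>
  define L where "L w = (\<Prod>v\<in>S - {w}. [:- v, 1:])" for w
  have degL: "degree (L w) = n" "coeff (L w) n = 1" if "w \<in> S" for w
  proof -
    show "degree (L w) = n"
      unfolding L_def using S that by (subst degree_prod_eq_sum_degree) auto
    moreover have "lead_coeff (L w) = 1"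
      unfolding L_def by (simp add: lead_coeff_prod)
    ultimately show "coeff (L w) n = 1"
      by simp
  qed
  \<comment> \<open>Both sides are monic of degree \<open>Suc n\<close>, so agreement on
    \<open>S\<close> suffices.\<close>
  have W_eq: "W = [:- w, 1:] * L w" if "w \<in> S" for w
  proof (rule poly_eqI_degree_lead_coeff[where n = "Suc n" and A = S])
    have nz: "L w \<noteq> 0"
      using degL(2)[OF that] by auto
    show deg: "degree ([:- w, 1:] * L w) \<le> Suc n"
      using nz degL(1)[OF that] by (subst degree_mult_eq) auto
    have "lead_coeff ([:- w, 1:] * L w) = 1"
      using degL[OF that] by (simp only: lead_coeff_mult) simp
    moreover have "degree ([:- w, 1:] * L w) = Suc n"
      using nz degL(1)[OF that] by (subst degree_mult_eq) auto
    ultimately show "coeff W (Suc n) = coeff ([:- w, 1:] * L w) (Suc n)"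
      using dW by simp
    show "poly W z = poly ([:- w, 1:] * L w) z" if "z \<in> S" for z
      using that S W by (auto simp: L_def poly_prod)
  qed (use dW S in auto)
  have dW_eq: "poly (pderiv W) w = poly (L w) w" if "w \<in> S" for w
    by (subst W_eq[OF that], subst pderiv_mult) (simp add: pderiv_pCons)
  have Lw: "poly (L w) w \<noteq> 0" for w
    using S by (auto simp: L_def poly_prod)
  have Lv: "poly (L w) v = 0" if "v \<in> S" "v \<noteq> w" for v w
    using S that by (auto simp: L_def poly_prod)
  have "Q = (\<Sum>w\<in>S. smult (poly Q w / poly (L w) w) (L w))"
  proof (rule poly_eqI_degree[where A = S])
    fix z assume z: "z \<in> S"
    have "poly (\<Sum>w\<in>S. smult (poly Q w / poly (L w) w) (L w)) z =
        (\<Sum>w\<in>S. if w = z then poly Q z else 0)"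
      unfolding poly_sum using z Lw Lv by (intro sum.cong) auto
    then show "poly Q z = poly (\<Sum>w\<in>S. smult (poly Q w / poly (L w) w) (L w)) z"
      using z S by simp
  next
    have "degree (\<Sum>w\<in>S. smult (poly Q w / poly (L w) w) (L w)) \<le> n"
      using S degL by (intro degree_sum_le) auto
    then show "degree (\<Sum>w\<in>S. smult (poly Q w / poly (L w) w) (L w)) < card S"
      using S by simp
  qed (use Q S in auto)
  then have "coeff Q n = (\<Sum>w\<in>S. poly Q w / poly (L w) w * coeff (L w) n)"
    by (metis (no_types, lifting) coeff_smult coeff_sum sum.cong)
  then show ?thesis
    using degL dW_eq by simp
qed

subsection \<open>Sums over the small roots\<close>

text \<open>\<open>card_L\<close> is the counting part of Frobenius' theorem; the final theorem
  obtains it from the enumeration \<open>lam\<close>. Together with the inverses it yields 2M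
  distinct roots, so every root is simple.\<close>

locale euler_roots =
  fixes M :: nat and L :: "real set"
  assumes L_eq: "L = {x. poly (euler_poly (2 * M)) x = 0 \<and> \<bar>x\<bar> < 1}"
    and card_L: "card L = M"
begin

lemma finite_L: "finite L"
proof -
  have "euler_poly (2 * M) \<noteq> 0"
    using lead_coeff_euler_poly[of "2 * M"] by auto
  from poly_roots_finite[OF this] show ?thesis
    unfolding L_eq by (rule rev_finite_subset) auto
qed

lemma L_D:
  assumes "x \<in> L"
  shows "poly (euler_poly (2 * M)) x = 0" "\<bar>x\<bar> < 1" "x \<noteq> 0" "x < 1" "M > 0"
  using assms euler_poly_root_nz[of "2 * M" x] finite_L card_L card_gt_0_iff[of L]
  by (auto simp: L_eq)

lemma inverse_root:
  assumes "x \<in> L"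
  shows "poly (euler_poly (2 * M)) (inverse x) = 0"
  using poly_euler_poly_inverse[OF L_D(3)[OF assms], of "2 * M"] L_D(1,3)[OF assms] by simp

text \<open>Apply \<open>sum_poly_div_pderiv\<close> to W = x E_{2M}. The assumption on
  \<open>Q\<close> makes the summand equal at x and 1/x, so the sum over all roots is Q(0), from the
  root 0, plus twice the sum over \<open>L\<close>.\<close>

lemma sum_L_antipalindromic:
  assumes deg: "degree Q \<le> 2 * M"
    and Q: "\<And>x. x \<in> L \<Longrightarrow> x ^ (2 * M) * poly Q (inverse x) = - poly Q x"
  shows "(\<Sum>x\<in>L. poly Q x / (x * poly (pderiv (euler_poly (2 * M))) x)) =
    (coeff Q (2 * M) - poly Q 0) / 2"
proof -
  let ?E = "euler_poly (2 * M)"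
  define W where "W = pCons 0 ?E"
  define f where "f x = poly Q x / poly (pderiv W) x" for x
  have E_nz: "?E \<noteq> 0"
    using lead_coeff_euler_poly[of "2 * M"] by auto
  have inv: "inj_on inverse L" "L \<inter> inverse ` L = {}" "0 \<notin> L \<union> inverse ` L"
  proof -
    show "L \<inter> inverse ` L = {}"
    proof safe
      fix x assume x: "inverse x \<in> L" "x \<in> L"
      then have "\<bar>x\<bar> < 1" "\<bar>inverse x\<bar> < 1"
        using L_D(2) by blast+
      then have "\<bar>x\<bar> * \<bar>inverse x\<bar> < 1 * 1"
        by (intro mult_strict_mono') simp_all
      then show "inverse x \<in> {}"
        using L_D(3)[OF x(2)] by (simp flip: abs_mult)
    qed
  qed (use L_D in \<open>auto simp: inj_on_def\<close>)
  have dW: "poly (pderiv W) x = poly ?E x + x * poly (pderiv ?E) x" for x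
    by (simp add: W_def pderiv_pCons)
  have f0: "f 0 = poly Q 0"
    by (simp add: f_def dW)
  have fL: "f x = poly Q x / (x * poly (pderiv ?E) x)" if "x \<in> L" for x
    using L_D[OF that] by (simp add: f_def dW)
  have finv: "f (inverse x) = f x" if x: "x \<in> L" for x
  proof -
    note xD = L_D[OF x]
    have r: "poly ?E (inverse x) = 0"
      by (rule inverse_root[OF x])
    have "f (inverse x) = poly Q (inverse x) / (inverse x * poly (pderiv ?E) (inverse x))"
      by (simp only: f_def dW r add_0)
    also have "\<dots> = x * poly Q (inverse x) / poly (pderiv ?E) (inverse x)"
      by (simp only: divide_inverse inverse_mult_distrib inverse_inverse_eq mult_ac)
    also have "\<dots> = x * (x ^ (2 * M) * poly Q (inverse x)) /
        (x ^ (2 * M) * poly (pderiv ?E) (inverse x))"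
      using xD(3) by simp
    \<comment> \<open>Two signs cancel: one from the antisymmetry of \<open>Q\<close>, one from the
      derivative at the inverse.\<close>
    also have "\<dots> = x * (- poly Q x) / - (x ^ 2 * poly (pderiv ?E) x)"
      using pderiv_euler_poly_inverse[OF xD(1)] xD(5) by (simp only: Q[OF x])
    also have "\<dots> = f x"
      using xD(3) by (simp add: fL[OF x] power2_eq_square)
    finally show ?thesis .
  qed
  define S where "S = insert 0 (L \<union> inverse ` L)"
  have "coeff Q (2 * M) = (\<Sum>x\<in>S. f x)"
    unfolding f_def
  proof (rule sum_poly_div_pderiv[symmetric])
    show "card S = Suc (2 * M)"
      using finite_L inv card_L by (simp add: S_def card_Un_disjoint card_image)
    show "poly W w = 0" if "w \<in> S" for w
      using that L_D(1) inverse_root by (auto simp: S_def W_def)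
  qed (use deg finite_L lead_coeff_euler_poly[of "2 * M"] E_nz in \<open>auto simp: S_def W_def\<close>)
  also have "\<dots> = f 0 + ((\<Sum>x\<in>L. f x) + (\<Sum>x\<in>L. f (inverse x)))"
    unfolding S_def using finite_L inv by (simp add: sum.union_disjoint sum.reindex)
  also have "(\<Sum>x\<in>L. f (inverse x)) = (\<Sum>x\<in>L. f x)"
    by (rule sum.cong[OF refl finv])
  finally show ?thesis
    by (simp add: f0 fL)
qed

text \<open>The coefficient of lambda^|beta| in the claimed formula for m = M + 1, without the
  factor (2m-1)! / h^(2m).\<close>

definition weight :: "real \<Rightarrow> real" where
  "weight x = (1 - x) ^ (2 * M + 3) / (x * poly (euler_poly (2 * M + 1)) x)"

lemma weight_eq:
  assumes "x \<in> L"
  shows "weight x = (1 - x) ^ (2 * M + 2) / (x ^ 2 * poly (pderiv (euler_poly (2 * M))) x)"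
  using L_D[OF assms] poly_euler_poly_Suc_root[of "2 * M" x]
  by (simp add: weight_def power2_eq_square eval_nat_numeral)

text \<open>The factor beside \<open>weight x\<close> is the sum of i^j x^i over i >= 1. By
  \<open>weight_eq\<close> the summand is Q(x) / (x E'(x)) with Q = (1 - x)^q F and q = 2M + 1 - j.
  As q is odd and F palindromic, Q is antisymmetric, with top coefficient -1 and Q(0) = 1.\<close>

lemma even_moment:
  assumes j: "even j" "0 < j" "j \<le> 2 * M"
  shows "(\<Sum>x\<in>L. weight x * (x * poly (euler_poly (j - 1)) x / (1 - x) ^ (j + 1))) = - 1"
proof -
  let ?E = "euler_poly (2 * M)" and ?F = "euler_poly (j - 1)"
  define q where "q = 2 * M + 1 - j"
  have q: "q + (j - 1) = 2 * M" "2 * M + 2 = j + 1 + q" "odd q"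
    using j by (auto simp: q_def)
  define Q where "Q = [:1, -1:] ^ q * ?F"
  have F_nz: "?F \<noteq> 0"
    using lead_coeff_euler_poly[of "j - 1"] by auto
  have deg: "degree Q = 2 * M"
    unfolding Q_def using q(1) F_nz by (simp add: degree_mult_eq degree_power_eq)
  have "lead_coeff Q = - 1"
    unfolding Q_def lead_coeff_mult lead_coeff_power using q(3) lead_coeff_euler_poly[of "j - 1"]
    by simp
  moreover have "poly Q 0 = 1"
    by (simp add: Q_def)
  moreover have "x ^ (2 * M) * poly Q (inverse x) = - poly Q x" if "x \<in> L" for x
  proof -
    have x: "x \<noteq> 0"
      using L_D that by blast
    have "x ^ (2 * M) * poly Q (inverse x) =
        (x * (1 - inverse x)) ^ q * (x ^ (j - 1) * poly ?F (inverse x))"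
      by (simp add: Q_def q(1)[symmetric] power_add power_mult_distrib)
    also have "x * (1 - inverse x) = - (1 - x)"
      using x by (simp add: field_simps)
    finally show ?thesis
      unfolding power_minus_odd[OF q(3)] poly_euler_poly_inverse[OF x, of "j - 1", symmetric]
      by (simp add: Q_def)
  qed
  ultimately have "(\<Sum>x\<in>L. poly Q x / (x * poly (pderiv ?E) x)) = - 1"
    using sum_L_antipalindromic[of Q] deg by simp
  also have "(\<Sum>x\<in>L. poly Q x / (x * poly (pderiv ?E) x)) =
      (\<Sum>x\<in>L. weight x * (x * poly ?F x / (1 - x) ^ (j + 1)))"
  proof (rule sum.cong[OF refl])
    fix x assume x: "x \<in> L"
    note xD = L_D[OF x]
    have "a * b / (x\<^sup>2 * e) * (x * c / a) = b * c / (x * e)" if "a \<noteq> 0" for a b c e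
      using that xD(3) by (simp add: power2_eq_square)
    from this[of "(1 - x) ^ (j + 1)" "(1 - x) ^ q"] show "poly Q x / (x * poly (pderiv ?E) x) =
        weight x * (x * poly ?F x / (1 - x) ^ (j + 1))"
      using xD(4) by (simp only: weight_eq[OF x] q(2) power_add Q_def) simp
  qed
  finally show ?thesis .
qed

text \<open>The factor (1 + x) / (1 - x) is the sum of x^|i| over all integers i. The numerator (1 -
  x)^(2M+1) (1 + x) / x is not a polynomial of degree at most 2M, so terms that vanish at the roots
  of E_{2M} are added.\<close>

lemma zeroth_moment:
  "(\<Sum>x\<in>L. weight x * ((1 + x) / (1 - x))) = 2 ^ (2 * M + 1) - 2"
proof -
  let ?E = "euler_poly (2 * M)"
  define A :: "real poly" where "A = [:1, -1:] ^ (2 * M + 1)"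
  have A: "coeff A i = (- 1) ^ i * real (2 * M + 1 choose i)" for i
    by (cases "i \<le> 2 * M + 1")
      (simp_all add: A_def coeff_linear_poly_power coeff_eq_0 degree_power_eq binomial_eq_0
        del: power_Suc)
  define P where "P = A * [:1, 1:]"
  have P: "coeff P (Suc i) = coeff A (Suc i) + coeff A i" for i
    by (simp add: P_def)
  obtain N where N: "P = pCons 1 N"
    by (metis A P_def coeff_0_power coeff_mult_0 coeff_pCons_0 mult_1 pCons_cases binomial_n_0 of_nat_1 power_0)
  obtain U where U: "?E = pCons 1 U"
    by (metis coeff_euler_poly_0 coeff_pCons_0 pCons_cases)
  have cN: "coeff N i = coeff A (Suc i) + coeff A i" for i
    using P[of i] by (simp add: N)
  have cU: "coeff U i = coeff ?E (Suc i)" for i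
    by (simp add: U)
  \<comment> \<open>Thus Q = (P - E) / x + x E. Subtracting E removes the pole at 0, since both
    constant terms are 1; x E cancels the leading term -x^(2M+1).\<close>
  define Q where "Q = N - U + pCons 0 ?E"
  have deg: "degree Q \<le> 2 * M"
  proof (rule degree_le, intro allI impI)
    fix i assume "2 * M < i"
    then obtain i' where i': "i = Suc i'" "i' \<ge> 2 * M"
      by (cases i) auto
    then show "coeff Q i = 0"
      using lead_coeff_euler_poly[of "2 * M"]
      by (cases "i' = 2 * M") (auto simp: Q_def cN cU A coeff_eq_0 binomial_eq_0)
  qed
  have e1: "coeff ?E 1 = 2 ^ (2 * M + 1) - 2 * real M - 2"
    using coeff_euler_poly_1[of "2 * M"] by simp
  have val: "poly Q x = (1 - x) ^ (2 * M + 1) * (1 + x) / x"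
    if "poly ?E x = 0" "x \<noteq> 0" for x
  proof -
    have "poly P x = 1 + x * poly N x" "poly ?E x = 1 + x * poly U x"
      by (simp_all add: N U)
    moreover have "poly Q x = poly N x - poly U x + x * poly ?E x"
      by (simp add: Q_def)
    ultimately have "x * poly Q x = (poly P x - 1) - (poly ?E x - 1) + x * (x * poly ?E x)"
      by (simp only:) (simp add: distrib_left right_diff_distrib)
    also have "\<dots> = (1 - x) ^ (2 * M + 1) * (1 + x)"
      using that by (simp add: P_def A_def algebra_simps)
    finally show ?thesis
      using that by (simp add: field_simps)
  qed
  have "poly Q 0 = 2 - 2 ^ (2 * M + 1)"
    using e1 by (simp add: Q_def poly_0_coeff_0 cN cU A)
  moreover have "coeff Q (2 * M) = 2 ^ (2 * M + 1) - 2"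
  \<comment> \<open>For M = 0 there is no index 2M - 1; otherwise that coefficient of E equals
    coefficient 1 by symmetry.\<close>
  proof (cases "M = 0")
    case True
    then show ?thesis
      by (simp add: Q_def cN cU A)
  next
    case False
    then have M: "2 * M = Suc (2 * M - 1)" "0 < 2 * M"
      by auto
    have "coeff ?E (2 * M - 1) = coeff ?E 1"
      using False by (intro coeff_euler_poly_palindromic) auto
    moreover have "coeff (pCons 0 ?E) (2 * M) = coeff ?E (2 * M - 1)"
      by (subst M(1)) (simp only: coeff_pCons_Suc)
    ultimately show ?thesis
      using e1 by (simp add: Q_def cN cU A coeff_eq_0 del: coeff_pCons)
  qed
  moreover have "x ^ (2 * M) * poly Q (inverse x) = - poly Q x" if "x \<in> L" for x
  proof -
    note xD = L_D[OF that]
    have r: "poly ?E (inverse x) = 0"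
      by (rule inverse_root[OF that])
    have "x ^ (2 * M) * poly Q (inverse x) =
        x ^ (2 * M) * ((1 - inverse x) ^ (2 * M + 1) * (1 + inverse x) / inverse x)"
      using xD(3) by (simp only: val[OF r] inverse_nonzero_iff_nonzero not_False_eq_True)
    also have "\<dots> = (x * (1 - inverse x)) ^ (2 * M + 1) * (1 + inverse x)"
      by (simp only: power_mult_distrib power_add power_one_right divide_inverse
          inverse_inverse_eq mult_ac)
    also have "x * (1 - inverse x) = - (1 - x)"
      using xD(3) by (simp add: field_simps)
    also have "1 + inverse x = (1 + x) / x"
      using xD(3) by (simp add: field_simps)
    finally show ?thesis
      unfolding val[OF xD(1,3)] by (subst (asm) power_minus_odd) simp_all
  qed
  ultimately have "(\<Sum>x\<in>L. poly Q x / (x * poly (pderiv ?E) x)) = 2 ^ (2 * M + 1) - 2"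
    using sum_L_antipalindromic[OF deg] by simp
  also have "(\<Sum>x\<in>L. poly Q x / (x * poly (pderiv ?E) x)) = (\<Sum>x\<in>L. weight x * ((1 + x) / (1 - x)))"
  proof (rule sum.cong[OF refl])
    fix x assume x: "x \<in> L"
    note xD = L_D[OF x]
    have "a * b / (x\<^sup>2 * e) * (c / a) = b * c / x / (x * e)" if "a \<noteq> 0" for a b c e
      using that by (simp add: power2_eq_square)
    from this[of "1 - x" "(1 - x) ^ (2 * M + 1)" "poly (pderiv ?E) x" "1 + x"]
    show "poly Q x / (x * poly (pderiv ?E) x) = weight x * ((1 + x) / (1 - x))"
      using xD(4) by (simp add: val[OF xD(1,3)] weight_eq[OF x])
  qed
  finally show ?thesis .
qed

end

subsection \<open>Sums over the integers\<close>

lemma has_sum_greaterThan_int: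
  "(f has_sum s) {b<..} \<longleftrightarrow> ((\<lambda>i. f (b + int (Suc i))) has_sum s) UNIV"
proof -
  have "bij_betw (\<lambda>i. b + int (Suc i)) UNIV {b<..}"
    by (rule bij_betw_byWitness[where f' = "\<lambda>z. nat (z - b - 1)"]) auto
  from has_sum_reindex_bij_betw[OF this, of f s] show ?thesis
    by simp
qed

lemma has_sum_uminus_int: "(f has_sum s) UNIV \<longleftrightarrow> ((\<lambda>z::int. f (- z)) has_sum s) UNIV"
  using has_sum_reindex_bij_betw[OF bij_uminus, where f = f] by simp

lemma has_sum_int:
  fixes f :: "int \<Rightarrow> 'a :: topological_comm_monoid_add"
  assumes "((\<lambda>i. f (int (Suc i))) has_sum s) UNIV" "((\<lambda>i. f (- int (Suc i))) has_sum t) UNIV"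
  shows "(f has_sum (f 0 + s + t)) UNIV"
proof -
  have "bij_betw (\<lambda>i. - int (Suc i)) UNIV {..<0}"
    by (rule bij_betw_byWitness[where f' = "\<lambda>z. nat (- z - 1)"]) auto
  from has_sum_reindex_bij_betw[OF this, of f t] assms(2) have "(f has_sum t) {..<0}"
    by simp
  moreover have "(f has_sum s) {0<..}"
    using assms(1) has_sum_greaterThan_int[where f = f and b = 0] by simp
  moreover have "(f has_sum f 0) {0}"
    by (simp add: has_sum_finiteI)
  ultimately have "(f has_sum (f 0 + s + t)) ({0} \<union> {0<..} \<union> {..<0})"
    by (intro has_sum_Un_disjoint) auto
  also have "{0} \<union> {0<..} \<union> {..<0} = (UNIV :: int set)"
    by auto
  finally show ?thesis .
qed

lemma has_sum_sum:
  fixes f :: "'a \<Rightarrow> 'b \<Rightarrow> 'c :: topological_comm_monoid_add"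
  assumes "\<And>a. a \<in> A \<Longrightarrow> (f a has_sum s a) B"
  shows "((\<lambda>x. \<Sum>a\<in>A. f a x) has_sum (\<Sum>a\<in>A. s a)) B"
  using assms by (induction A rule: infinite_finite_induct) (auto intro: has_sum_add)

section \<open>Absolute summability and uniqueness of convolution inverses\<close>

lemma summable_on_abs_real_iff:
  "(\<lambda>x. \<bar>f x :: real\<bar>) summable_on A \<longleftrightarrow> f summable_on A"
  using summable_on_iff_abs_summable_on_real[of f A] by simp

text \<open>The bound \<open>1 + \<bar>\<gamma>\<bar> \<le> 2 * max \<bar>\<gamma>\<bar> \<bar>1 - \<gamma>\<bar>\<close> lets the convolutions at \<open>0\<close> and \<open>1\<close> supply the
  weighted summability that Fubini needs in the associativity argument.\<close>

lemma summable_weight: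
  fixes D :: "int \<Rightarrow> real"
  assumes "\<And>\<beta>. (\<lambda>\<gamma>. D \<gamma> * of_int \<bar>\<beta> - \<gamma>\<bar> ^ n) summable_on UNIV"
  shows "(\<lambda>\<gamma>. \<bar>D \<gamma>\<bar> * of_int (1 + \<bar>\<gamma>\<bar>) ^ n) summable_on UNIV"
proof -
  have abs: "(\<lambda>\<gamma>. \<bar>D \<gamma> * of_int \<bar>\<beta> - \<gamma>\<bar> ^ n\<bar>) summable_on UNIV" for \<beta>
    unfolding summable_on_abs_real_iff by (rule assms)
  have "(\<lambda>\<gamma>. 2 ^ n * (\<bar>D \<gamma> * of_int \<bar>0 - \<gamma>\<bar> ^ n\<bar> + \<bar>D \<gamma> * of_int \<bar>1 - \<gamma>\<bar> ^ n\<bar>)) summable_on UNIV"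
    by (rule summable_on_cmult_right[OF summable_on_add[OF abs abs]])
  then show ?thesis
  proof (rule summable_on_comparison_test)
    fix \<gamma> :: int
    have "real_of_int (1 + \<bar>\<gamma>\<bar>) ^ n \<le> 2 ^ n * (of_int \<bar>0 - \<gamma>\<bar> ^ n + of_int \<bar>1 - \<gamma>\<bar> ^ n)"
    proof (cases "\<gamma> = 0")
      case True
      have "(1::real) * 1 \<le> 2 ^ n * (0 ^ n + 1)"
        by (intro mult_mono) simp_all
      with True show ?thesis
        by simp
    next
      case False
      then have "real_of_int (1 + \<bar>\<gamma>\<bar>) \<le> of_int (2 * \<bar>\<gamma>\<bar>)"
        unfolding of_int_le_iff by simp
      then have "real_of_int (1 + \<bar>\<gamma>\<bar>) ^ n \<le> of_int (2 * \<bar>\<gamma>\<bar>) ^ n"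
        by (intro power_mono) simp_all
      also have "\<dots> = 2 ^ n * of_int \<bar>0 - \<gamma>\<bar> ^ n"
        by (simp add: power_mult_distrib)
      also have "\<dots> \<le> 2 ^ n * (of_int \<bar>0 - \<gamma>\<bar> ^ n + of_int \<bar>1 - \<gamma>\<bar> ^ n)"
        by (intro mult_left_mono) simp_all
      finally show ?thesis .
    qed
    then have "\<bar>D \<gamma>\<bar> * of_int (1 + \<bar>\<gamma>\<bar>) ^ n \<le>
        \<bar>D \<gamma>\<bar> * (2 ^ n * (of_int \<bar>0 - \<gamma>\<bar> ^ n + of_int \<bar>1 - \<gamma>\<bar> ^ n))"
      by (intro mult_left_mono) simp_all
    then show "\<bar>D \<gamma>\<bar> * of_int (1 + \<bar>\<gamma>\<bar>) ^ n \<le>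
        2 ^ n * (\<bar>D \<gamma> * of_int \<bar>0 - \<gamma>\<bar> ^ n\<bar> + \<bar>D \<gamma> * of_int \<bar>1 - \<gamma>\<bar> ^ n\<bar>)"
      by (simp add: abs_mult power_abs algebra_simps)
  qed simp
qed

text \<open>Sum D(gamma) D'(eta) |beta - gamma - eta|^n over all pairs in both orders: the inner sum
  collapses to a multiple of delta, leaving c D(beta) or c D'(beta).\<close>

lemma convolution_inverse_unique:
  fixes D D' :: "int \<Rightarrow> real"
  assumes c: "c \<noteq> 0"
    and D: "\<And>\<beta>. ((\<lambda>\<gamma>. D \<gamma> * of_int \<bar>\<beta> - \<gamma>\<bar> ^ n) has_sum (if \<beta> = 0 then c else 0)) UNIV"
    and D': "\<And>\<beta>. ((\<lambda>\<gamma>. D' \<gamma> * of_int \<bar>\<beta> - \<gamma>\<bar> ^ n) has_sum (if \<beta> = 0 then c else 0)) UNIV"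
  shows "D = D'"
proof
  fix \<beta> :: int
  define w where "w \<gamma> = real_of_int (1 + \<bar>\<gamma>\<bar>) ^ n" for \<gamma> :: int
  define F where "F \<gamma> \<eta> = D \<gamma> * (D' \<eta> * of_int \<bar>\<beta> - \<gamma> - \<eta>\<bar> ^ n)" for \<gamma> \<eta>
  define u where "u \<gamma> = \<bar>D \<gamma>\<bar> * w \<gamma>" for \<gamma>
  define v where "v \<eta> = \<bar>D' \<eta>\<bar> * w \<eta>" for \<eta>
  have u: "u summable_on UNIV"
    unfolding u_def w_def by (rule summable_weight) (rule has_sum_imp_summable[OF D])
  have v: "v summable_on UNIV"
    unfolding v_def w_def by (rule summable_weight) (rule has_sum_imp_summable[OF D'])
  have nonneg: "0 \<le> u \<gamma>" "0 \<le> v \<gamma>" "0 \<le> w \<gamma>" for \<gamma>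
    by (simp_all add: u_def v_def w_def)
  \<comment> \<open>A product majorant of \<open>F\<close>: |beta - gamma - eta| is at most (1 +
    |beta|) (1 + |gamma|) (1 + |eta|).\<close>
  have "(\<lambda>(\<gamma>, \<eta>). w \<beta> * (u \<gamma> * v \<eta>)) summable_on UNIV \<times> UNIV"
  proof (rule summable_on_SigmaI)
    show "((\<lambda>\<eta>. case (\<gamma>, \<eta>) of (\<gamma>, \<eta>) \<Rightarrow> w \<beta> * (u \<gamma> * v \<eta>)) has_sum
        w \<beta> * (u \<gamma> * infsum v UNIV)) UNIV" for \<gamma>
      using v by (auto intro!: has_sum_cmult_right)
    show "(\<lambda>\<gamma>. w \<beta> * (u \<gamma> * infsum v UNIV)) summable_on UNIV"
      using u by (intro summable_on_cmult_right summable_on_cmult_left)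
  qed (auto simp: nonneg)
  then have "(\<lambda>(\<gamma>, \<eta>). \<bar>F \<gamma> \<eta>\<bar>) summable_on UNIV \<times> UNIV"
  proof (rule summable_on_comparison_test, clarsimp)
    fix \<gamma> \<eta> :: int
    have "\<bar>\<beta> - \<gamma> - \<eta>\<bar> \<le> (1 + \<bar>\<beta>\<bar>) * ((1 + \<bar>\<gamma>\<bar>) * (1 + \<bar>\<eta>\<bar>))"
    proof -
      have "1 + x + y + z \<le> (1 + x) * ((1 + y) * (1 + z))" if "0 \<le> x" "0 \<le> y" "0 \<le> z" for x y z :: int
      proof -
        have "0 \<le> y * z" "0 \<le> x * (y + z + y * z)"
          using that by simp_all
        then show ?thesis
          by (simp add: algebra_simps)
      qed
      then have "1 + \<bar>\<beta>\<bar> + \<bar>\<gamma>\<bar> + \<bar>\<eta>\<bar> \<le> (1 + \<bar>\<beta>\<bar>) * ((1 + \<bar>\<gamma>\<bar>) * (1 + \<bar>\<eta>\<bar>))"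
        by simp
      moreover have "\<bar>\<beta> - \<gamma> - \<eta>\<bar> \<le> 1 + \<bar>\<beta>\<bar> + \<bar>\<gamma>\<bar> + \<bar>\<eta>\<bar>"
        by linarith
      ultimately show ?thesis
        by (rule order_trans[rotated])
    qed
    then have "real_of_int \<bar>\<beta> - \<gamma> - \<eta>\<bar> ^ n \<le> of_int ((1 + \<bar>\<beta>\<bar>) * ((1 + \<bar>\<gamma>\<bar>) * (1 + \<bar>\<eta>\<bar>))) ^ n"
      by (intro power_mono) (simp_all only: of_int_le_iff of_int_0_le_iff abs_ge_zero)
    also have "\<dots> = w \<beta> * (w \<gamma> * w \<eta>)"
      by (simp only: w_def of_int_mult power_mult_distrib)
    finally have "\<bar>D \<gamma>\<bar> * \<bar>D' \<eta>\<bar> * real_of_int \<bar>\<beta> - \<gamma> - \<eta>\<bar> ^ n \<le>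
        \<bar>D \<gamma>\<bar> * \<bar>D' \<eta>\<bar> * (w \<beta> * (w \<gamma> * w \<eta>))"
      by (intro mult_left_mono) simp_all
    then show "\<bar>F \<gamma> \<eta>\<bar> \<le> w \<beta> * (u \<gamma> * v \<eta>)"
      by (simp add: F_def u_def v_def abs_mult power_abs mult_ac)
  qed auto
  then have "(\<lambda>(\<gamma>, \<eta>). F \<gamma> \<eta>) summable_on UNIV \<times> UNIV"
    by (simp only: summable_on_abs_real_iff case_prod_unfold)
  then have swap: "(\<Sum>\<^sub>\<infinity>\<gamma>. \<Sum>\<^sub>\<infinity>\<eta>. F \<gamma> \<eta>) = (\<Sum>\<^sub>\<infinity>\<eta>. \<Sum>\<^sub>\<infinity>\<gamma>. F \<gamma> \<eta>)"
    by (rule infsum_swap_banach)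
  have single: "(\<Sum>\<^sub>\<infinity>\<gamma>. f \<gamma> * (if \<beta> - \<gamma> = 0 then c else 0)) = f \<beta> * c" for f :: "int \<Rightarrow> real"
    by (intro infsumI has_sum_finite_neutralI[where B = "{\<beta>}"]) auto
  have "(\<Sum>\<^sub>\<infinity>\<eta>. F \<gamma> \<eta>) = D \<gamma> * (if \<beta> - \<gamma> = 0 then c else 0)" for \<gamma>
    unfolding F_def by (intro infsumI has_sum_cmult_right D')
  moreover have "(\<Sum>\<^sub>\<infinity>\<gamma>. F \<gamma> \<eta>) = D' \<eta> * (if \<beta> - \<eta> = 0 then c else 0)" for \<eta>
  proof -
    have "F \<gamma> \<eta> = D' \<eta> * (D \<gamma> * of_int \<bar>(\<beta> - \<eta>) - \<gamma>\<bar> ^ n)" for \<gamma>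
      by (simp add: F_def algebra_simps)
    then show ?thesis
      by (simp only:) (intro infsumI has_sum_cmult_right D)
  qed
  ultimately have "D \<beta> * c = D' \<beta> * c"
    using swap by (simp only: single)
  with c show "D \<beta> = D' \<beta>"
    by simp
qed

subsection \<open>The discrete analogue\<close>

context euler_roots
begin

text \<open>The three cases of the formula merge, up to the constant factor: the geometric sum is
  common to all, and only |gamma| <= 1 carries a correction.\<close>

definition analogue :: "int \<Rightarrow> real" where
  "analogue \<gamma> = (\<Sum>x\<in>L. weight x * x ^ nat \<bar>\<gamma>\<bar>) +
     (if \<bar>\<gamma>\<bar> = 1 then 1 else if \<gamma> = 0 then - (2 ^ (2 * M + 1)) else 0)"

lemma analogue_uminus [simp]: "analogue (- \<gamma>) = analogue \<gamma>"
  by (simp add: analogue_def)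

text \<open>All arguments to the right of \<open>b\<close> are positive, so the only correction met
  is the one at 1, when \<open>b = 0\<close>. The case \<open>b = 0\<close> serves the moments,
  general \<open>b\<close> the one-sided part of the convolution.\<close>

lemma analogue_half_sum:
  fixes b j :: nat
  assumes P: "\<And>x. x \<in> L \<Longrightarrow> ((\<lambda>i. real (Suc i) ^ j * x ^ Suc i) has_sum P x) UNIV"
  shows "((\<lambda>i. real (Suc i) ^ j * analogue (int b + int (Suc i))) has_sum
    ((\<Sum>x\<in>L. weight x * x ^ b * P x) + (if b = 0 then 1 else 0))) UNIV"
proof -
  have "((\<lambda>i. if i = 0 \<and> b = 0 then 1 else 0 :: real) has_sum (if b = 0 then 1 else 0)) UNIV"
    by (rule has_sum_finite_neutralI[where B = "{0}"]) auto
  moreover have "((\<lambda>i. \<Sum>x\<in>L. weight x * x ^ b * (real (Suc i) ^ j * x ^ Suc i)) has_sum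
      (\<Sum>x\<in>L. weight x * x ^ b * P x)) UNIV"
    by (intro has_sum_sum has_sum_cmult_right P)
  ultimately have "((\<lambda>i. (\<Sum>x\<in>L. weight x * x ^ b * (real (Suc i) ^ j * x ^ Suc i)) +
      (if i = 0 \<and> b = 0 then 1 else 0)) has_sum
      ((\<Sum>x\<in>L. weight x * x ^ b * P x) + (if b = 0 then 1 else 0))) UNIV"
    by (rule has_sum_add[rotated])
  also have "(\<lambda>i. (\<Sum>x\<in>L. weight x * x ^ b * (real (Suc i) ^ j * x ^ Suc i)) +
      (if i = 0 \<and> b = 0 then 1 else 0)) =
      (\<lambda>i. real (Suc i) ^ j * analogue (int b + int (Suc i)))"
  proof
    fix i
    have nat: "nat \<bar>int b + int (Suc i)\<bar> = b + Suc i"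
      by simp
    have "real (Suc i) ^ j * (\<Sum>x\<in>L. weight x * x ^ (b + Suc i)) =
        (\<Sum>x\<in>L. weight x * x ^ b * (real (Suc i) ^ j * x ^ Suc i))"
      by (simp add: sum_distrib_left power_add mult_ac)
    then show "(\<Sum>x\<in>L. weight x * x ^ b * (real (Suc i) ^ j * x ^ Suc i)) +
        (if i = 0 \<and> b = 0 then 1 else 0) = real (Suc i) ^ j * analogue (int b + int (Suc i))"
      unfolding analogue_def nat by (auto simp: distrib_left)
  qed
  finally show ?thesis .
qed

text \<open>By evenness the half-line sums are H and (-1)^j H. They cancel for odd j; H = 0 for even
  j > 0 by \<open>even_moment\<close>; for j = 0 the value at 0 joins in and
  \<open>zeroth_moment\<close> balances it.\<close>

lemma analogue_moment:
  assumes j: "j \<le> 2 * M + 1"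
  shows "((\<lambda>\<gamma>. analogue \<gamma> * of_int \<gamma> ^ j) has_sum 0) UNIV"
proof -
  \<comment> \<open>\<open>power_sums_has_sum\<close> covers positive exponents only; for
    \<open>j = 0\<close> the series is geometric, starting at x.\<close>
  define P where "P x = (if j = 0 then x / (1 - x)
    else x * poly (euler_poly (j - 1)) x / (1 - x) ^ (j + 1))" for x
  have P: "((\<lambda>i. real (Suc i) ^ j * x ^ Suc i) has_sum P x) UNIV" if "x \<in> L" for x
  proof (cases "j = 0")
    case True
    have "(\<lambda>i. x ^ i) sums (1 / (1 - x))" "(\<lambda>i. \<bar>x\<bar> ^ i) sums (1 / (1 - \<bar>x\<bar>))"
      using L_D(2)[OF that] by (auto intro: geometric_sums)
    then have "((\<lambda>i. x ^ i) has_sum (1 / (1 - x))) UNIV"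
      by (intro norm_summable_imp_has_sum) (auto simp: power_abs sums_iff)
    from has_sum_cmult_right[OF this, of x] True show ?thesis
      by (simp add: P_def)
  next
    case False
    then show ?thesis
      using power_sums_has_sum[OF L_D(2)[OF that], of "j - 1"] by (simp add: P_def)
  qed
  define H where "H = (\<Sum>x\<in>L. weight x * P x) + 1"
  have "((\<lambda>i. real (Suc i) ^ j * analogue (int (Suc i))) has_sum H) UNIV"
    using analogue_half_sum[of j P 0] P by (simp add: H_def)
  then have half: "((\<lambda>i. analogue (int (Suc i)) * of_int (int (Suc i)) ^ j) has_sum H) UNIV"
    by (simp add: mult.commute)
  have "((\<lambda>i. analogue (- int (Suc i)) * of_int (- int (Suc i)) ^ j) has_sum (- 1) ^ j * H) UNIV"
  proof -
    have "of_int (- int (Suc i)) ^ j = (- 1 :: real) ^ j * of_int (int (Suc i)) ^ j" for i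
      by (subst power_mult_distrib[symmetric]) simp
    with has_sum_cmult_right[OF half, of "(- 1) ^ j"] show ?thesis
      by (simp only: analogue_uminus mult_ac)
  qed
  with half have total: "((\<lambda>\<gamma>. analogue \<gamma> * of_int \<gamma> ^ j) has_sum
      (analogue 0 * of_int 0 ^ j + H + (- 1) ^ j * H)) UNIV"
    by (intro has_sum_int)
  have "analogue 0 * of_int 0 ^ j + H + (- 1) ^ j * H = 0"
  proof (cases "j = 0")
    case True
    have "analogue 0 + 2 * H = (\<Sum>x\<in>L. weight x * 1 + 2 * (weight x * P x)) + 2 - 2 ^ (2 * M + 1)"
      by (simp add: analogue_def H_def sum.distrib sum_distrib_left)
    also have "(\<Sum>x\<in>L. weight x * 1 + 2 * (weight x * P x)) =
        (\<Sum>x\<in>L. weight x * ((1 + x) / (1 - x)))"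
    proof (rule sum.cong[OF refl])
      fix x assume "x \<in> L"
      then have "1 + 2 * P x = (1 + x) / (1 - x)"
        using L_D(4)[of x] True by (simp add: P_def field_simps)
      then show "weight x * 1 + 2 * (weight x * P x) = weight x * ((1 + x) / (1 - x))"
        by (metis distrib_left mult.left_commute)
    qed
    finally show ?thesis
      unfolding zeroth_moment using True by simp
  next
    case False
    show ?thesis
    proof (cases "even j")
      case True
      then have "j \<le> 2 * M"
        using j by (cases "j = 2 * M + 1") auto
      with even_moment[OF True] False have "H = 0"
        by (simp add: H_def P_def)
      with False show ?thesis
        by simp
    next
      case odd: False
      with False show ?thesis
        by simp
    qed
  qed
  with total show ?thesis
    by simp
qed

text \<open>For odd n, |z|^n is z^n plus, where z < 0, twice (-z)^n; here z = b - gamma. The moments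
  annihilate z^n by the binomial theorem.\<close>

lemma analogue_convolution_nonneg:
  fixes b :: nat
  shows "((\<lambda>\<gamma>. analogue \<gamma> * of_int \<bar>int b - \<gamma>\<bar> ^ (2 * M + 1)) has_sum (if b = 0 then 2 else 0)) UNIV"
proof -
  let ?n = "2 * M + 1" and ?c = "if b = 0 then 1 else 0 :: real"
  have "((\<lambda>\<gamma>. \<Sum>k\<le>?n. of_nat (?n choose k) * (- 1) ^ k * of_int (int b) ^ (?n - k) *
      (analogue \<gamma> * of_int \<gamma> ^ k)) has_sum
      (\<Sum>k\<le>?n. of_nat (?n choose k) * (- 1) ^ k * of_int (int b) ^ (?n - k) * 0)) UNIV"
    by (intro has_sum_sum has_sum_cmult_right analogue_moment) simp
  also have "(\<lambda>\<gamma>. \<Sum>k\<le>?n. of_nat (?n choose k) * (- 1) ^ k * of_int (int b) ^ (?n - k) *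
      (analogue \<gamma> * of_int \<gamma> ^ k)) = (\<lambda>\<gamma>. analogue \<gamma> * of_int (int b - \<gamma>) ^ ?n)"
  proof
    fix \<gamma> :: int
    have "real_of_int (int b - \<gamma>) ^ ?n = (- of_int \<gamma> + of_int (int b)) ^ ?n"
      by simp
    also have "\<dots> = (\<Sum>k\<le>?n. of_nat (?n choose k) * ((- 1) ^ k * of_int \<gamma> ^ k) * of_int (int b) ^ (?n - k))"
      unfolding binomial_ring power_mult_distrib[symmetric] by simp
    finally show "(\<Sum>k\<le>?n. of_nat (?n choose k) * (- 1) ^ k * of_int (int b) ^ (?n - k) *
        (analogue \<gamma> * of_int \<gamma> ^ k)) = analogue \<gamma> * of_int (int b - \<gamma>) ^ ?n"
      by (simp only: sum_distrib_left mult_ac)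
  qed
  finally have poly: "((\<lambda>\<gamma>. analogue \<gamma> * of_int (int b - \<gamma>) ^ ?n) has_sum 0) UNIV"
    by simp
  \<comment> \<open>Each geometric piece sums to a multiple of E_{2M}(x) = 0, so only the correction
    at 1 is left; its double is the value 2 at \<open>b = 0\<close>.\<close>
  have "((\<lambda>i. real (Suc i) ^ ?n * analogue (int b + int (Suc i))) has_sum
      ((\<Sum>x\<in>L. weight x * x ^ b * 0) + ?c)) UNIV"
  proof (rule analogue_half_sum)
    fix x assume "x \<in> L"
    from power_sums_has_sum[OF L_D(2)[OF this], of "2 * M"] L_D(1)[OF this]
    show "((\<lambda>i. real (Suc i) ^ ?n * x ^ Suc i) has_sum 0) UNIV"
      by simp
  qed
  then have "((\<lambda>\<gamma>. of_int (\<gamma> - int b) ^ ?n * analogue \<gamma>) has_sum ?c) {int b<..}"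
    by (subst has_sum_greaterThan_int) simp
  then have "((\<lambda>\<gamma>. if \<gamma> > int b then of_int (\<gamma> - int b) ^ ?n * analogue \<gamma> else 0) has_sum ?c) UNIV"
    by (rule has_sum_cong_neutral[THEN iffD1, rotated -1]) auto
  from has_sum_add[OF poly has_sum_cmult_right[OF this, of 2]]
  have "((\<lambda>\<gamma>. analogue \<gamma> * of_int (int b - \<gamma>) ^ ?n +
      2 * (if \<gamma> > int b then of_int (\<gamma> - int b) ^ ?n * analogue \<gamma> else 0)) has_sum (0 + 2 * ?c)) UNIV" .
  also have "(\<lambda>\<gamma>. analogue \<gamma> * of_int (int b - \<gamma>) ^ ?n +
      2 * (if \<gamma> > int b then of_int (\<gamma> - int b) ^ ?n * analogue \<gamma> else 0)) =
      (\<lambda>\<gamma>. analogue \<gamma> * of_int \<bar>int b - \<gamma>\<bar> ^ ?n)"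
  proof
    fix \<gamma> :: int
    have "real_of_int (int b - \<gamma>) ^ ?n = - (of_int (\<gamma> - int b) ^ ?n)"
      using power_minus_odd[of ?n "real_of_int (\<gamma> - int b)"] by simp
    then show "analogue \<gamma> * of_int (int b - \<gamma>) ^ ?n +
        2 * (if \<gamma> > int b then of_int (\<gamma> - int b) ^ ?n * analogue \<gamma> else 0) =
        analogue \<gamma> * of_int \<bar>int b - \<gamma>\<bar> ^ ?n"
      by (cases "\<gamma> > int b") (simp_all only: abs_of_neg abs_of_nonneg if_True if_False, auto)
  qed
  finally show ?thesis
    by (cases "b = 0") simp_all
qed

lemma analogue_convolution:
  "((\<lambda>\<gamma>. analogue \<gamma> * of_int \<bar>\<beta> - \<gamma>\<bar> ^ (2 * M + 1)) has_sum (if \<beta> = 0 then 2 else 0)) UNIV"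
proof (cases "\<beta> \<ge> 0")
  case True
  then show ?thesis
    using analogue_convolution_nonneg[of "nat \<beta>"] by simp
next
  case False
  have "\<bar>\<beta> - - \<gamma>\<bar> = \<bar>int (nat (- \<beta>)) - \<gamma>\<bar>" for \<gamma>
    using False by simp
  then show ?thesis
    using analogue_convolution_nonneg[of "nat (- \<beta>)"] False
    by (subst has_sum_uminus_int) (simp only: analogue_uminus, simp)
qed

end

text \<open>An odd power times the sign is a power of |beta|, and the 2 undoes the 1/2 in
  \<open>discrete_G\<close>. For real families \<open>has_sum\<close> includes absolute convergence,
  so it captures both demands at once.\<close>

lemma is_discrete_analogue_iff:
  assumes "h > 0"
  shows "is_discrete_analogue (Suc M) h D \<longleftrightarrow>
    (\<forall>\<beta>. ((\<lambda>\<gamma>. h ^ (2 * M + 2) / fact (2 * M + 1) * D \<gamma> * of_int \<bar>\<beta> - \<gamma>\<bar> ^ (2 * M + 1)) has_sum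
      (if \<beta> = 0 then 2 else 0)) UNIV)"
proof -
  define c where "c = h ^ (2 * M + 2) / fact (2 * M + 1)"
  have c: "c \<noteq> 0"
    using assms by (simp add: c_def)
  have G: "D \<gamma> * discrete_G (Suc M) h \<beta> = (1 / (2 * h)) * (c * D \<gamma> * of_int \<bar>\<beta>\<bar> ^ (2 * M + 1))"
    for \<beta> \<gamma>
  proof -
    have "of_int \<beta> ^ (2 * M + 1) * sgn (of_int \<beta>) = (of_int \<bar>\<beta>\<bar> :: real) ^ (2 * M + 1)"
      by (cases \<beta> "0 :: int" rule: linorder_cases) (simp_all add: power_minus_odd)
    moreover have "sgn (h * of_int \<beta>) = sgn (of_int \<beta> :: real)"
      using assms by (simp add: sgn_mult)
    ultimately show ?thesis
      using assms unfolding discrete_G_def c_def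
      by (simp add: power_mult_distrib field_simps del: of_int_abs)
  qed
  have "(\<lambda>\<gamma>. \<bar>D \<gamma> * discrete_G (Suc M) h (\<beta> - \<gamma>)\<bar>) summable_on UNIV \<and>
      h * discrete_conv D (discrete_G (Suc M) h) \<beta> = discrete_delta \<beta> \<longleftrightarrow>
      ((\<lambda>\<gamma>. D \<gamma> * discrete_G (Suc M) h (\<beta> - \<gamma>)) has_sum ((if \<beta> = 0 then 1 else 0) / h)) UNIV" for \<beta>
    using assms unfolding summable_on_abs_real_iff discrete_conv_def discrete_delta_def has_sum_iff
    by (auto simp: field_simps)
  also have "\<dots> \<beta> \<longleftrightarrow> ((\<lambda>\<gamma>. c * D \<gamma> * of_int \<bar>\<beta> - \<gamma>\<bar> ^ (2 * M + 1)) has_sum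
      (if \<beta> = 0 then 2 else 0)) UNIV" for \<beta>
    unfolding G using assms by (subst has_sum_cmult_right_iff) auto
  finally show ?thesis
    unfolding is_discrete_analogue_def c_def by blast
qed

theorem theorem1:
  fixes m :: nat and h :: real and lam :: "nat \<Rightarrow> real" and D :: "int \<Rightarrow> real"
  assumes "m \<ge> 1" and "h > 0"
    and "bij_betw lam {1..m - 1} {x. poly (euler_poly (2 * m - 2)) x = 0 \<and> \<bar>x\<bar> < 1}"
  shows "is_discrete_analogue m h D \<longleftrightarrow>
    (\<forall>\<beta>. D \<beta> = fact (2 * m - 1) / h ^ (2 * m) *
      (if \<bar>\<beta>\<bar> \<ge> 2 then
         (\<Sum>k = 1..m - 1. (1 - lam k) ^ (2 * m + 1) * lam k ^ nat \<bar>\<beta>\<bar> /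
            (lam k * poly (euler_poly (2 * m - 1)) (lam k)))
       else if \<bar>\<beta>\<bar> = 1 then
         1 + (\<Sum>k = 1..m - 1. (1 - lam k) ^ (2 * m + 1) /
            poly (euler_poly (2 * m - 1)) (lam k))
       else
         - (2 ^ (2 * m - 1)) + (\<Sum>k = 1..m - 1. (1 - lam k) ^ (2 * m + 1) /
            (lam k * poly (euler_poly (2 * m - 1)) (lam k)))))"
proof -
  obtain M where m: "m = Suc M"
    using assms(1) by (cases m) auto
  define L where "L = {x. poly (euler_poly (2 * M)) x = 0 \<and> \<bar>x\<bar> < 1}"
  have bij: "bij_betw lam {1..M} L"
    using assms(3) by (simp add: m L_def)
  interpret euler_roots M L
    by unfold_locales (use bij_betw_same_card[OF bij] in \<open>simp_all add: L_def\<close>)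
  define c where "c = h ^ (2 * M + 2) / fact (2 * M + 1)"
  have c: "c \<noteq> 0"
    using assms(2) by (simp add: c_def)
  \<comment> \<open>Existence is \<open>analogue_convolution\<close>, uniqueness
    \<open>convolution_inverse_unique\<close>, both for the rescaled function.\<close>
  have "is_discrete_analogue m h D \<longleftrightarrow> (\<lambda>\<gamma>. c * D \<gamma>) = analogue"
    unfolding m is_discrete_analogue_iff[OF assms(2)] c_def[symmetric]
  proof
    assume "(\<lambda>\<gamma>. c * D \<gamma>) = analogue"
    then have "c * D \<gamma> = analogue \<gamma>" for \<gamma>
      by (rule fun_cong)
    then show "\<forall>\<beta>. ((\<lambda>\<gamma>. c * D \<gamma> * of_int \<bar>\<beta> - \<gamma>\<bar> ^ (2 * M + 1)) has_sum
        (if \<beta> = 0 then 2 else 0)) UNIV"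
      by (simp only: analogue_convolution simp_thms)
  qed (rule convolution_inverse_unique[OF _ _ analogue_convolution], simp_all)
  also have "\<dots> \<longleftrightarrow> (\<forall>\<beta>. D \<beta> = (1 / c) * analogue \<beta>)"
    using c by (auto simp: fun_eq_iff field_simps)
  finally have iff: "is_discrete_analogue m h D \<longleftrightarrow> (\<forall>\<beta>. D \<beta> = (1 / c) * analogue \<beta>)" .
  have inv_c: "1 / c = fact (2 * m - 1) / h ^ (2 * m)"
    by (simp add: c_def m)
  have "analogue \<beta> = (if \<bar>\<beta>\<bar> \<ge> 2 then
         (\<Sum>k = 1..m - 1. (1 - lam k) ^ (2 * m + 1) * lam k ^ nat \<bar>\<beta>\<bar> /
            (lam k * poly (euler_poly (2 * m - 1)) (lam k)))
       else if \<bar>\<beta>\<bar> = 1 then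
         1 + (\<Sum>k = 1..m - 1. (1 - lam k) ^ (2 * m + 1) /
            poly (euler_poly (2 * m - 1)) (lam k))
       else
         - (2 ^ (2 * m - 1)) + (\<Sum>k = 1..m - 1. (1 - lam k) ^ (2 * m + 1) /
            (lam k * poly (euler_poly (2 * m - 1)) (lam k))))" for \<beta>
  proof -
    have idx: "m - 1 = M" "2 * m + 1 = 2 * M + 3" "2 * m - 1 = 2 * M + 1"
      by (simp_all add: m)
    have "lam k \<noteq> 0" if "k \<in> {1..M}" for k
      using L_D(3) bij_betwE[OF bij] that by blast
    \<comment> \<open>The first power of lambda_k cancels the nonzero lambda_k in the denominator,
      whence the different shape of the case |beta| = 1.\<close>
    then have one: "(\<Sum>k = 1..M. weight (lam k) * lam k ^ 1) =
        (\<Sum>k = 1..M. (1 - lam k) ^ (2 * M + 3) / poly (euler_poly (2 * M + 1)) (lam k))"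
      by (intro sum.cong) (auto simp: weight_def)
    have eq: "analogue \<beta> = (\<Sum>k = 1..M. weight (lam k) * lam k ^ nat \<bar>\<beta>\<bar>) +
        (if \<bar>\<beta>\<bar> = 1 then 1 else if \<beta> = 0 then - (2 ^ (2 * M + 1)) else 0)"
      unfolding analogue_def by (subst sum.reindex_bij_betw[OF bij, symmetric]) simp
    consider "\<bar>\<beta>\<bar> \<ge> 2" | "\<bar>\<beta>\<bar> = 1" | "\<beta> = 0"
      by linarith
    then show ?thesis
    proof cases
      case 1
      then show ?thesis
        unfolding idx eq by (auto simp: weight_def)
    next
      case 2
      then have "nat \<bar>\<beta>\<bar> = 1"
        by simp
      with 2 show ?thesis
        unfolding idx eq by (simp only: one) simp
    next
      case 3
      then show ?thesis
        unfolding idx eq by (simp add: weight_def)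
    qed
  qed
  then show ?thesis
    by (simp only: iff inv_c)
qed

end
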